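(* Let $(e_i)$ be a normalized conditional spreading basis for a Banach space $X$. Let $(d_n)=(e_1,e_2-e_1,e_3-e_2,\ldots)$ be the difference basis and let $D=[(d_{2n})_{n=1}^\infty]$. Then $X$ is isomorphic to $D\oplus Y$, where $Y=[(e_1+e_2,\,e_3+e_4,\ldots)]$, and $Y$ is isomorphic to $X$.
   Context: $[\,\cdot\,]$ denotes closed linear span. A basic sequence is spreading if it is equivalent to each of its subsequences; it is conditional if it is not unconditional. *)

theory Defs
  imports "HOL-Analysis.Analysis"
begin

definition closed_span :: "'a::real_normed_vector set \<Rightarrow> 'a set" where
  "closed_span A = closure (span A)"

text \<open>In the following definition \<open>S\<close> is meant to be a closed linear subspace.\<close>

definition schauder_basis_of :: "'a::real_normed_vector set \<Rightarrow> (nat \<Rightarrow> 'a) \<Rightarrow> bool" where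
  "schauder_basis_of S e \<longleftrightarrow>
     range e \<subseteq> S \<and> (\<forall>x\<in>S. \<exists>!a::nat \<Rightarrow> real. (\<lambda>n. a n *\<^sub>R e n) sums x)"

definition basic_sequence :: "(nat \<Rightarrow> 'a::real_normed_vector) \<Rightarrow> bool" where
  "basic_sequence e \<longleftrightarrow> schauder_basis_of (closed_span (range e)) e"

definition equivalent_sequences ::
    "(nat \<Rightarrow> 'a::real_normed_vector) \<Rightarrow> (nat \<Rightarrow> 'b::real_normed_vector) \<Rightarrow> bool" where
  "equivalent_sequences x y \<longleftrightarrow>
     (\<exists>C>0. \<forall>(a::nat \<Rightarrow> real) n.
        norm (\<Sum>i<n. a i *\<^sub>R x i) \<le> C * norm (\<Sum>i<n. a i *\<^sub>R y i) \<and>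
        norm (\<Sum>i<n. a i *\<^sub>R y i) \<le> C * norm (\<Sum>i<n. a i *\<^sub>R x i))"

definition spreading :: "(nat \<Rightarrow> 'a::real_normed_vector) \<Rightarrow> bool" where
  "spreading e \<longleftrightarrow>
     basic_sequence e \<and> (\<forall>s. strict_mono s \<longrightarrow> equivalent_sequences e (e \<circ> s))"

text \<open>Unconditional convergence of a series is \<^const>\<open>summable_on\<close>: convergence of the net of
  all finite partial sums.\<close>

definition unconditional :: "(nat \<Rightarrow> 'a::real_normed_vector) \<Rightarrow> bool" where
  "unconditional e \<longleftrightarrow>
     basic_sequence e \<and>
     (\<forall>a::nat \<Rightarrow> real. summable (\<lambda>n. a n *\<^sub>R e n) \<longrightarrow> (\<lambda>n. a n *\<^sub>R e n) summable_on UNIV)"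

definition conditional :: "(nat \<Rightarrow> 'a::real_normed_vector) \<Rightarrow> bool" where
  "conditional e \<longleftrightarrow> basic_sequence e \<and> \<not> unconditional e"

text \<open>Sequences are indexed from \<open>0\<close>, so a term written \<open>d\<^sub>k\<close> with \<open>k \<ge> 1\<close> in the usual
  one-based notation is \<open>difference_sequence e (k - 1)\<close>.\<close>

definition difference_sequence :: "(nat \<Rightarrow> 'a::real_normed_vector) \<Rightarrow> nat \<Rightarrow> 'a" where
  "difference_sequence e n = (if n = 0 then e 0 else e n - e (n - 1))"

text \<open>Isomorphism of linear subspaces as topological vector spaces; linearity is only
  required on the domain \<open>S\<close>.\<close>

definition isomorphic_subspaces ::
    "'a::real_normed_vector set \<Rightarrow> 'b::real_normed_vector set \<Rightarrow> bool" where
  "isomorphic_subspaces S T \<longleftrightarrow>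
     (\<exists>f g. homeomorphism S T f g \<and>
        (\<forall>x\<in>S. \<forall>y\<in>S. \<forall>a b::real. f (a *\<^sub>R x + b *\<^sub>R y) = a *\<^sub>R f x + b *\<^sub>R f y))"

end

(* For a spreading basis, placing two coordinates at the positions p < q or p < r of a triple and
   subtracting shows that e (2n) |-> 0, e (2n+1) |-> e (2n) - e (2n+1) extends to a bounded operator,
   and similarly with the roles of the two coordinates exchanged. Hence the swap R of e (2n) and
   e (2n+1) is a bounded involution; D and Y are its eigenspaces for -1 and 1, so X = D + Y directly.
   The map e i |-> e (i div 2) / 2 is bounded as well and inverts e n |-> e (2n) + e (2n+1) on Y. *)

theory Submission
  imports Defs
begin

section \<open>Bounded operators and their values on a Schauder basis\<close>

lemma schauder_basis_bounded_linear_eqI: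
  fixes F G :: "'a::real_normed_vector \<Rightarrow> 'b::real_normed_vector"
  assumes "schauder_basis_of UNIV e" "bounded_linear F" "bounded_linear G" "\<And>i. F (e i) = G (e i)"
  shows "F x = G x"
proof -
  obtain a where a: "(\<lambda>n. a n *\<^sub>R e n) sums x"
    using assms(1) unfolding schauder_basis_of_def by blast
  have "(\<lambda>n. a n *\<^sub>R F (e n)) sums F x" "(\<lambda>n. a n *\<^sub>R G (e n)) sums G x"
    using bounded_linear.sums[OF assms(2) a] bounded_linear.sums[OF assms(3) a]
    by (simp_all add: linear_cmul bounded_linear.linear assms(2,3))
  then show ?thesis
    using assms(4) by (simp add: sums_unique2)
qed

text \<open>\<open>F x\<close> is the limit of the images of the partial sums of \<open>x\<close>,
  and these images lie in \<open>span A\<close>.\<close>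

lemma schauder_basis_image_in_closed_span:
  fixes F :: "'a::real_normed_vector \<Rightarrow> 'b::real_normed_vector"
  assumes "schauder_basis_of UNIV e" "bounded_linear F" "\<And>i. F (e i) \<in> span A"
  shows "F x \<in> closed_span A"
proof -
  obtain a where a: "(\<lambda>n. a n *\<^sub>R e n) sums x"
    using assms(1) unfolding schauder_basis_of_def by blast
  have "(\<lambda>n. a n *\<^sub>R F (e n)) sums F x"
    using bounded_linear.sums[OF assms(2) a] by (simp add: linear_cmul bounded_linear.linear assms(2))
  then have lim: "(\<lambda>n. \<Sum>i<n. a i *\<^sub>R F (e i)) \<longlonglongrightarrow> F x"
    by (simp add: sums_def)
  have "(\<Sum>i<n. a i *\<^sub>R F (e i)) \<in> span A" for n
    by (intro span_sum span_scale assms(3))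
  then show ?thesis
    using lim unfolding closed_span_def closure_sequential
    by (intro exI[of _ "\<lambda>n. \<Sum>i<n. a i *\<^sub>R F (e i)"]) simp
qed

lemma closed_span_subset:
  assumes "A \<subseteq> S" "subspace S" "closed S"
  shows "closed_span A \<subseteq> S"
  unfolding closed_span_def
  by (intro closure_minimal span_minimal assms)

lemma closed_Collect_bounded_linear_eq:
  fixes F G :: "'a::real_normed_vector \<Rightarrow> 'b::real_normed_vector"
  assumes "bounded_linear F" "bounded_linear G"
  shows "closed {x. F x = G x}" "subspace {x. F x = G x}"
proof -
  show "closed {x. F x = G x}"
    by (intro closed_Collect_eq linear_continuous_on assms)
  interpret F: bounded_linear F by fact
  interpret G: bounded_linear G by fact
  show "subspace {x. F x = G x}"
    by (auto simp: subspace_def F.add G.add F.scaleR G.scaleR)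
qed

text \<open>The estimate on finite sums carries the Cauchy property from the expansion of
  \<open>x\<close> to the series with \<open>v\<close> in place of \<open>e\<close>. Its sum is
  linear in \<open>x\<close> because coefficients are unique, and the norm bound survives the
  limit.\<close>

lemma schauder_basis_bounded_linear_extension:
  fixes e :: "nat \<Rightarrow> 'a::banach" and v :: "nat \<Rightarrow> 'b::banach"
  assumes basis: "schauder_basis_of UNIV e"
    and bound: "\<And>a n. norm (\<Sum>i<n. a i *\<^sub>R v i) \<le> C * norm (\<Sum>i<n. a i *\<^sub>R e i)"
  shows "\<exists>T. bounded_linear T \<and> (\<forall>i. T (e i) = v i)"
proof -
  have "\<exists>a. (\<lambda>n. a n *\<^sub>R e n) sums x" for x
    using basis unfolding schauder_basis_of_def by blast
  then obtain c where c: "\<And>x. (\<lambda>n. c x n *\<^sub>R e n) sums x"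
    by metis
  \<comment> \<open>Uniqueness of the expansion; additivity, homogeneity and the values at basis
    vectors are read off from it.\<close>
  have c_eq: "c x = a" if "(\<lambda>n. a n *\<^sub>R e n) sums x" for x a
    using basis c[of x] that unfolding schauder_basis_of_def by blast
  have c_add: "c (x + y) = (\<lambda>n. c x n + c y n)" for x y
    by (rule c_eq) (use sums_add[OF c[of x] c[of y]] in \<open>simp add: scaleR_add_left\<close>)
  have c_scale: "c (r *\<^sub>R x) = (\<lambda>n. r * c x n)" for r x
    by (rule c_eq) (use bounded_linear.sums[OF bounded_linear_scaleR_right[of r] c[of x]] in simp)
  have c_e: "c (e i) = (\<lambda>n. if n = i then 1 else 0)" for i
    by (rule c_eq)
       (use sums_single[of i "\<lambda>n. e n"] in \<open>simp add: if_distrib[of "\<lambda>t. t *\<^sub>R _"] cong: if_cong\<close>)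
  \<comment> \<open>Setting the coefficients below \<open>m\<close> to zero turns the bound on
    initial sums into one on blocks.\<close>
  have block: "norm (\<Sum>i=m..<n. a i *\<^sub>R v i) \<le> C * norm (\<Sum>i=m..<n. a i *\<^sub>R e i)" for a m n
  proof -
    have *: "(\<Sum>i<n. (if m \<le> i then a i else 0) *\<^sub>R w i) = (\<Sum>i=m..<n. a i *\<^sub>R w i)"
      for w :: "nat \<Rightarrow> 'c::real_normed_vector"
      by (rule sum.mono_neutral_cong_right) auto
    show ?thesis
      using bound[where n = n and a = "\<lambda>i. if m \<le> i then a i else 0"] by (simp only: *)
  qed
  \<comment> \<open>\<open>C\<close> has no prescribed sign, and the Cauchy argument divides by the
    constant.\<close>
  have C: "C * t \<le> max C 1 * t" if "t \<ge> 0" for t :: real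
    using that by (intro mult_right_mono) auto
  have summable: "summable (\<lambda>n. c x n *\<^sub>R v n)" for x
    unfolding summable_Cauchy
  proof (intro allI impI)
    fix \<epsilon> :: real assume "\<epsilon> > 0"
    then have "\<epsilon> / max C 1 > 0" by simp
    from summable_Cauchy[THEN iffD1, rule_format, OF sums_summable[OF c[of x]] this]
    obtain N where N: "norm (\<Sum>i=m..<n. c x i *\<^sub>R e i) < \<epsilon> / max C 1" if "m \<ge> N" for m n
      by blast
    have "norm (\<Sum>i=m..<n. c x i *\<^sub>R v i) < \<epsilon>" if "m \<ge> N" for m n
    proof -
      have "norm (\<Sum>i=m..<n. c x i *\<^sub>R v i) \<le> max C 1 * norm (\<Sum>i=m..<n. c x i *\<^sub>R e i)"
        by (rule order_trans[OF block C[OF norm_ge_zero]])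
      also have "\<dots> < \<epsilon>"
        using N[OF that, of n] by (simp add: pos_less_divide_eq mult.commute)
      finally show ?thesis .
    qed
    then show "\<exists>N. \<forall>m\<ge>N. \<forall>n. norm (\<Sum>i=m..<n. c x i *\<^sub>R v i) < \<epsilon>"
      by (intro exI[of _ N] allI impI)
  qed
  define T where "T x = (\<Sum>n. c x n *\<^sub>R v n)" for x
  have T: "(\<lambda>n. c x n *\<^sub>R v n) sums T x" for x
    unfolding T_def using summable by (rule summable_sums)
  have "bounded_linear T"
  proof (rule bounded_linear_intro[where K = C])
    show "T (x + y) = T x + T y" for x y
      using sums_add[OF T[of x] T[of y]] T[of "x + y"]
      by (simp add: c_add scaleR_add_left sums_unique2)
    show "T (r *\<^sub>R x) = r *\<^sub>R T x" for r x
      using bounded_linear.sums[OF bounded_linear_scaleR_right[of r] T[of x]] T[of "r *\<^sub>R x"]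
      by (simp add: c_scale sums_unique2)
    show "norm (T x) \<le> norm x * C" for x
      unfolding mult.commute[of _ C]
    proof (rule LIMSEQ_le)
      show "(\<lambda>n. norm (\<Sum>i<n. c x i *\<^sub>R v i)) \<longlonglongrightarrow> norm (T x)"
        using T[of x] unfolding sums_def by (rule tendsto_norm)
      show "(\<lambda>n. C * norm (\<Sum>i<n. c x i *\<^sub>R e i)) \<longlonglongrightarrow> C * norm x"
        using c[of x] unfolding sums_def by (intro tendsto_intros)
      show "\<exists>N. \<forall>n\<ge>N. norm (\<Sum>i<n. c x i *\<^sub>R v i) \<le> C * norm (\<Sum>i<n. c x i *\<^sub>R e i)"
        using bound by blast
    qed
  qed
  moreover have "T (e i) = v i" for i
    using T[of "e i"] sums_single[of i v]
    by (simp add: c_e if_distrib[of "\<lambda>t. t *\<^sub>R _"] sums_unique2 cong: if_cong)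
  ultimately show ?thesis by blast
qed

section \<open>Operators obtained from the spreading property\<close>

lemma schauder_basis_spreading_shift:
  fixes e :: "nat \<Rightarrow> 'a::banach"
  assumes "schauder_basis_of UNIV e" "spreading e" "strict_mono s"
  obtains S C where "bounded_linear S" "\<And>i. S (e i) = e (s i)" "\<And>x. norm x \<le> C * norm (S x)"
proof -
  obtain C where
      1: "norm (\<Sum>i<n. a i *\<^sub>R e i) \<le> C * norm (\<Sum>i<n. a i *\<^sub>R e (s i))" and
      2: "norm (\<Sum>i<n. a i *\<^sub>R e (s i)) \<le> C * norm (\<Sum>i<n. a i *\<^sub>R e i)" for a n
    using assms(2,3) unfolding spreading_def equivalent_sequences_def o_def by blast
  obtain S where S: "bounded_linear S" "\<And>i. S (e i) = e (s i)"
    using schauder_basis_bounded_linear_extension[OF assms(1) 2] by blast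
  \<comment> \<open>The other half of the equivalence, passed from partial sums to the limit, bounds
    \<open>S\<close> from below.\<close>
  have "norm x \<le> C * norm (S x)" for x
  proof -
    obtain a where a: "(\<lambda>n. a n *\<^sub>R e n) sums x"
      using assms(1) unfolding schauder_basis_of_def by blast
    have Sa: "(\<lambda>n. a n *\<^sub>R e (s n)) sums S x"
      using bounded_linear.sums[OF S(1) a] by (simp add: linear_cmul bounded_linear.linear S)
    show ?thesis
    proof (rule LIMSEQ_le)
      show "(\<lambda>n. norm (\<Sum>i<n. a i *\<^sub>R e i)) \<longlonglongrightarrow> norm x"
        using a unfolding sums_def by (rule tendsto_norm)
      show "(\<lambda>n. C * norm (\<Sum>i<n. a i *\<^sub>R e (s i))) \<longlonglongrightarrow> C * norm (S x)"
        using Sa unfolding sums_def by (intro tendsto_intros)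
    qed (use 1 in blast)
  qed
  with S show thesis by (rule that)
qed

text \<open>Since \<open>S\<close> is bounded below, sums of the \<open>v i\<close> may be estimated
  after applying \<open>S\<close>, where they become images under \<open>L\<close> of sums of the
  \<open>e i\<close>. Boundedness of \<open>T\<close> thus reduces to an identity on basis
  vectors.\<close>

lemma schauder_basis_lift_through_shift:
  fixes e v :: "nat \<Rightarrow> 'a::banach"
  assumes "schauder_basis_of UNIV e" "bounded_linear L"
    and S: "bounded_linear S" "\<And>x. norm x \<le> C * norm (S x)"
    and Sv: "\<And>i. S (v i) = L (e i)"
  obtains T where "bounded_linear T" "\<And>i. T (e i) = v i"
proof -
  interpret S: bounded_linear S by fact
  interpret L: bounded_linear L by fact
  obtain K where K: "\<And>x. norm (L x) \<le> K * norm x"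
    using L.bounded by (metis mult.commute)
  have "norm (\<Sum>i<n. a i *\<^sub>R v i) \<le> (\<bar>C\<bar> * K) * norm (\<Sum>i<n. a i *\<^sub>R e i)" for a n
  proof -
    have "norm (\<Sum>i<n. a i *\<^sub>R v i) \<le> C * norm (S (\<Sum>i<n. a i *\<^sub>R v i))"
      by (rule S(2))
    also have "S (\<Sum>i<n. a i *\<^sub>R v i) = L (\<Sum>i<n. a i *\<^sub>R e i)"
      by (simp add: S.sum L.sum S.scaleR L.scaleR Sv)
    also have "C * norm (L (\<Sum>i<n. a i *\<^sub>R e i)) \<le> \<bar>C\<bar> * (K * norm (\<Sum>i<n. a i *\<^sub>R e i))"
      by (intro mult_mono K) auto
    finally show ?thesis by (simp add: mult.assoc)
  qed
  from schauder_basis_bounded_linear_extension[OF assms(1) this] that show thesis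
    by blast
qed

lemma strict_mono_interleave:
  fixes p q :: "nat \<Rightarrow> nat"
  assumes "\<And>n. p n < q n" "\<And>n. q n < p (Suc n)"
  shows "strict_mono (\<lambda>i. if even i then p (i div 2) else q (i div 2))"
  unfolding strict_mono_Suc_iff using assms by auto

lemma nat_parity_cases:
  assumes "\<And>n. P (2 * n)" "\<And>n. P (Suc (2 * n))"
  shows "P (i::nat)"
  using assms by (metis evenE oddE Suc_eq_plus1)

text \<open>The pairs \<open>p n < q n\<close> follow one another without overlap, so the index map
  is strictly increasing and spreading applies.\<close>

lemma spreading_interleave_shift:
  fixes e :: "nat \<Rightarrow> 'a::banach"
  assumes "schauder_basis_of UNIV e" "spreading e"
    and "\<And>n. p n < q n" "\<And>n. q n < p (Suc n)"
  obtains S C where "bounded_linear S" "\<And>x. norm x \<le> C * norm (S x)"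
    "\<And>n. S (e (2 * n)) = e (p n)" "\<And>n. S (e (Suc (2 * n))) = e (q n)"
proof -
  obtain S C where S: "bounded_linear S" "\<And>x. norm x \<le> C * norm (S x)"
      "\<And>i. S (e i) = e (if even i then p (i div 2) else q (i div 2))"
    by (rule schauder_basis_spreading_shift[OF assms(1,2) strict_mono_interleave[of p q]])
       (use assms(3,4) in auto)
  show thesis
    by (rule that[OF S(1,2)]) (simp_all add: S(3))
qed

lemma spreading_pair_operators:
  fixes e :: "nat \<Rightarrow> 'a::banach"
  assumes "schauder_basis_of UNIV e" "spreading e"
  obtains T0 T1 where "bounded_linear T0" "bounded_linear T1"
    "\<And>n. T0 (e (2 * n)) = e (Suc (2 * n)) - e (2 * n)" "\<And>n. T0 (e (Suc (2 * n))) = 0"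
    "\<And>n. T1 (e (2 * n)) = 0" "\<And>n. T1 (e (Suc (2 * n))) = e (2 * n) - e (Suc (2 * n))"
proof -
  \<comment> \<open>\<open>A\<close>, \<open>B\<close>, \<open>G\<close> put the \<open>n\<close>-th
    pair at places 0 and 1, 0 and 2, 1 and 2 of the \<open>n\<close>-th triple.\<close>
  obtain A a where A: "bounded_linear A" "\<And>x. norm x \<le> a * norm (A x)"
      "\<And>n. A (e (2 * n)) = e (3 * n)" "\<And>n. A (e (Suc (2 * n))) = e (3 * n + 1)"
    by (rule spreading_interleave_shift[OF assms, of "\<lambda>n. 3 * n" "\<lambda>n. 3 * n + 1"]) auto
  obtain B where B: "bounded_linear B"
      "\<And>n. B (e (2 * n)) = e (3 * n)" "\<And>n. B (e (Suc (2 * n))) = e (3 * n + 2)"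
    by (rule spreading_interleave_shift[OF assms, of "\<lambda>n. 3 * n" "\<lambda>n. 3 * n + 2"]) auto
  obtain G g where G: "bounded_linear G" "\<And>x. norm x \<le> g * norm (G x)"
      "\<And>n. G (e (2 * n)) = e (3 * n + 1)" "\<And>n. G (e (Suc (2 * n))) = e (3 * n + 2)"
    by (rule spreading_interleave_shift[OF assms, of "\<lambda>n. 3 * n + 1" "\<lambda>n. 3 * n + 2"]) auto
  interpret A: bounded_linear A by (rule A)
  interpret G: bounded_linear G by (rule G)
  \<comment> \<open>In \<open>w\<close> the term \<open>i - 1\<close> occurs only for odd
    \<open>i\<close>, so the subtraction is never truncated.\<close>
  define u where "u i = (if even i then e (Suc i) - e i else 0)" for i
  define w where "w i = (if even i then 0 else e (i - 1) - e i)" for i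
  \<comment> \<open>\<open>G\<close> and \<open>B\<close> agree on odd-indexed vectors, so the
    difference cancels there; on \<open>e (2 * n)\<close> it is
    \<open>e (3 * n + 1) - e (3 * n)\<close>, the image of \<open>u (2 * n)\<close> under
    \<open>A\<close>.\<close>
  have "A (u i) = G (e i) - B (e i)" for i
    by (rule nat_parity_cases[of _ i]) (simp_all add: u_def A.diff A(3,4) B(2,3) G(3,4))
  then obtain T0 where T0: "bounded_linear T0" "\<And>i. T0 (e i) = u i"
    by (rule schauder_basis_lift_through_shift
        [OF assms(1) bounded_linear_sub[OF G(1) B(1)] A(1,2)]) blast
  \<comment> \<open>Here the cancellation is on even-indexed vectors, and \<open>G\<close> is the
    operator to lift through.\<close>
  have "G (w i) = A (e i) - B (e i)" for i
    by (rule nat_parity_cases[of _ i]) (simp_all add: w_def G.diff A(3,4) B(2,3) G(3,4))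
  then obtain T1 where T1: "bounded_linear T1" "\<And>i. T1 (e i) = w i"
    by (rule schauder_basis_lift_through_shift
        [OF assms(1) bounded_linear_sub[OF A(1) B(1)] G(1,2)]) blast
  show thesis
    by (rule that[OF T0(1) T1(1)]) (simp_all add: T0(2) T1(2) u_def w_def)
qed

theorem proposition2p9:
  fixes e :: "nat \<Rightarrow> 'a::banach" and D Y :: "'a set"
  assumes "schauder_basis_of (UNIV :: 'a set) e"
    and "\<And>n. norm (e n) = 1"
    and "spreading e"
    and "conditional e"
    and D: "D = closed_span (range (\<lambda>n. difference_sequence e (2 * n + 1)))"
    and Y: "Y = closed_span (range (\<lambda>n. e (2 * n) + e (2 * n + 1)))"
  shows "isomorphic_subspaces (UNIV :: 'a set) (D \<times> Y) \<and>
         isomorphic_subspaces Y (UNIV :: 'a set)"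
proof -
  note basis = assms(1)
  note eqI = schauder_basis_bounded_linear_eqI[OF basis]

  \<comment> \<open>Splitting the space by the pair swap\<close>
  obtain T0 T1 where T0: "bounded_linear T0"
      "\<And>n. T0 (e (2 * n)) = e (Suc (2 * n)) - e (2 * n)" "\<And>n. T0 (e (Suc (2 * n))) = 0"
    and T1: "bounded_linear T1"
      "\<And>n. T1 (e (2 * n)) = 0" "\<And>n. T1 (e (Suc (2 * n))) = e (2 * n) - e (Suc (2 * n))"
    by (rule spreading_pair_operators[OF basis assms(3)]) blast
  define R where "R x = x + T0 x + T1 x" for x
  have R: "bounded_linear R"
    unfolding R_def by (intro bounded_linear_add bounded_linear_ident T0 T1)
  interpret R: bounded_linear R by (rule R)
  have R_e: "R (e (2 * n)) = e (Suc (2 * n))" "R (e (Suc (2 * n))) = e (2 * n)" for n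
    by (simp_all add: R_def T0 T1)
  have RR: "R (R x) = x" for x
  proof (rule eqI[OF bounded_linear_compose[OF R R] bounded_linear_ident])
    show "R (R (e i)) = e i" for i
      by (rule nat_parity_cases[of _ i]) (simp_all add: R_e)
  qed
  \<comment> \<open>The projections of the involution \<open>R\<close> onto its eigenspaces for 1
    and -1.\<close>
  define P where "P x = (1/2) *\<^sub>R (x + R x)" for x
  define Q where "Q x = (1/2) *\<^sub>R (x - R x)" for x
  have P: "bounded_linear P"
    unfolding P_def by (intro bounded_linear_const_scaleR bounded_linear_add bounded_linear_ident R)
  have Q: "bounded_linear Q"
    unfolding Q_def by (intro bounded_linear_const_scaleR bounded_linear_sub bounded_linear_ident R)
  interpret P: bounded_linear P by (rule P)
  interpret Q: bounded_linear Q by (rule Q)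
  have P_plus_Q: "Q x + P x = x" for x
    by (simp add: P_def Q_def algebra_simps flip: scaleR_add_left)
  have Y_gen: "e (2 * n) + e (Suc (2 * n)) \<in> span (range (\<lambda>n. e (2 * n) + e (2 * n + 1)))" for n
    by (intro span_base) auto
  \<comment> \<open>With indices from 0, \<open>difference_sequence e (2 * n + 1)\<close> is the
    one-based even term of index \<open>2 * n + 2\<close>, a difference within a single
    pair.\<close>
  have D_gen: "e (Suc (2 * n)) - e (2 * n)
      \<in> span (range (\<lambda>n. difference_sequence e (2 * n + 1)))" for n
    by (intro span_base) (auto simp: difference_sequence_def)
  have P_in: "P x \<in> Y" for x
    unfolding Y
  proof (rule schauder_basis_image_in_closed_span[OF basis P])
    show "P (e i) \<in> span (range (\<lambda>n. e (2 * n) + e (2 * n + 1)))" for i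
      by (rule nat_parity_cases[of _ i])
         (use Y_gen in \<open>auto simp: P_def R_e add.commute intro!: span_scale\<close>)
  qed
  have Q_in: "Q x \<in> D" for x
    unfolding D
  proof (rule schauder_basis_image_in_closed_span[OF basis Q])
    \<comment> \<open>\<open>Q (e (2 * n))\<close> is minus half a generator, so it needs a
      membership fact of its own.\<close>
    have D_gen': "(1/2) *\<^sub>R (e (2 * n) - e (Suc (2 * n)))
        \<in> span (range (\<lambda>n. difference_sequence e (2 * n + 1)))" for n
      using span_scale[OF D_gen[of n], of "-1/2"] by (simp add: algebra_simps)
    show "Q (e i) \<in> span (range (\<lambda>n. difference_sequence e (2 * n + 1)))" for i
      by (rule nat_parity_cases[of _ i])
         (simp_all only: Q_def R_e span_scale D_gen D_gen')
  qed
  have R_Y: "R y = y" if "y \<in> Y" for y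
  proof -
    \<comment> \<open>The fixed space of \<open>R\<close> is a closed subspace, so the generators
      suffice; the same argument serves \<open>D\<close> with eigenvalue -1.\<close>
    have "Y \<subseteq> {y. R y = y}"
      unfolding Y using closed_Collect_bounded_linear_eq[OF R bounded_linear_ident]
      by (intro closed_span_subset) (auto simp: R.add R_e)
    then show ?thesis using that by blast
  qed
  have R_D: "R d = - d" if "d \<in> D" for d
  proof -
    have "D \<subseteq> {d. R d = - d}"
      unfolding D using closed_Collect_bounded_linear_eq[OF R bounded_linear_minus[OF bounded_linear_ident]]
      by (intro closed_span_subset) (auto simp: difference_sequence_def R.diff R_e)
    then show ?thesis using that by blast
  qed
  have P_Y: "P y = y" if "y \<in> Y" for y
    using R_Y[OF that] by (simp add: P_def flip: scaleR_2)
  have homeo: "homeomorphism UNIV (D \<times> Y) (\<lambda>x. (Q x, P x)) (\<lambda>(d, y). d + y)"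
  proof (rule homeomorphismI)
    show "continuous_on UNIV (\<lambda>x. (Q x, P x))"
      by (intro continuous_on_Pair linear_continuous_on P Q)
    show "continuous_on (D \<times> Y) (\<lambda>(d, y). d + y)"
      unfolding case_prod_beta by (intro continuous_intros)
    show "(\<lambda>x. (Q x, P x)) ` UNIV \<subseteq> D \<times> Y"
      using P_in Q_in by auto
    show "(case (Q x, P x) of (d, y) \<Rightarrow> d + y) = x" for x
      by (simp add: P_plus_Q)
    show "(Q (case z of (d, y) \<Rightarrow> d + y), P (case z of (d, y) \<Rightarrow> d + y)) = z" if z_in: "z \<in> D \<times> Y" for z
    proof -
      obtain d y where z: "z = (d, y)" "d \<in> D" "y \<in> Y"
        using z_in by blast
      \<comment> \<open>Each projection kills the other eigenspace; as \<open>Q\<close> and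
        \<open>P\<close> add up to the identity, each then fixes its own.\<close>
      have "P d = 0" "Q y = 0"
        by (simp_all add: P_def Q_def R_D R_Y z)
      moreover have "Q d = d" "P y = y"
        using P_plus_Q[of d] \<open>P d = 0\<close> P_Y z by auto
      ultimately show ?thesis
        by (simp add: z P.add Q.add)
    qed
  qed auto
  have 1: "isomorphic_subspaces (UNIV :: 'a set) (D \<times> Y)"
    unfolding isomorphic_subspaces_def
    by (intro exI conjI, rule homeo) (auto simp: P.add Q.add P.scaleR Q.scaleR)

  \<comment> \<open>The isomorphism between \<open>Y\<close> and the whole space\<close>
  obtain A a where A: "bounded_linear A" "\<And>i. A (e i) = e (2 * i)" "\<And>x. norm x \<le> a * norm (A x)"
    by (rule schauder_basis_spreading_shift[OF basis assms(3), of "\<lambda>i. 2 * i"])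
       (auto simp: strict_mono_def)
  obtain B where B: "bounded_linear B" "\<And>i. B (e i) = e (Suc (2 * i))"
    by (rule schauder_basis_spreading_shift[OF basis assms(3), of "\<lambda>i. Suc (2 * i)"])
       (auto simp: strict_mono_def)
  define G where "G x = A x + B x" for x
  have G: "bounded_linear G"
    unfolding G_def by (intro bounded_linear_add A B)
  interpret A: bounded_linear A by (rule A)
  interpret G: bounded_linear G by (rule G)
  have G_e: "G (e n) = e (2 * n) + e (Suc (2 * n))" for n
    by (simp add: G_def A(2) B(2))
  \<comment> \<open>The identity plus \<open>T1\<close> maps both members of a pair to the even one,
    which is \<open>A (e (i div 2))\<close>. The factor 1/2 makes the two contributions to
    \<open>W (G (e n))\<close> add up to \<open>e n\<close>.\<close>
  have "A ((1/2) *\<^sub>R e (i div 2)) = (1/2) *\<^sub>R (e i + T1 (e i))" for i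
    by (rule nat_parity_cases[of _ i]) (simp_all add: A.scaleR A(2) T1)
  then obtain W where W: "bounded_linear W" "\<And>i. W (e i) = (1/2) *\<^sub>R e (i div 2)"
    by (rule schauder_basis_lift_through_shift
        [OF basis bounded_linear_const_scaleR[OF bounded_linear_add[OF bounded_linear_ident T1(1)]] A(1,3)]) blast
  interpret W: bounded_linear W by (rule W)
  have WG: "W (G x) = x" for x
    by (rule eqI[OF bounded_linear_compose[OF W(1) G] bounded_linear_ident])
       (simp add: G_e W.add W(2) flip: scaleR_add_left)
  have GW: "G (W x) = P x" for x
  proof (rule eqI[OF bounded_linear_compose[OF G W(1)] P])
    show "G (W (e i)) = P (e i)" for i
      by (rule nat_parity_cases[of _ i])
         (simp_all add: W(2) G.scaleR G_e P_def R_e add.commute)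
  qed
  \<comment> \<open>\<open>G x = G (W (G x)) = P (G x)\<close>, which lies in the range of
    \<open>P\<close>.\<close>
  have G_in: "G x \<in> Y" for x
    using P_in[of "G x"] by (simp add: WG flip: GW)
  \<comment> \<open>\<open>G\<close> inverts \<open>W\<close> on \<open>Y\<close> because
    \<open>G (W y) = P y\<close> and \<open>P\<close> fixes \<open>Y\<close>.\<close>
  have "homeomorphism Y UNIV W G"
    by (rule homeomorphismI)
       (use G_in in \<open>auto simp: WG GW P_Y intro: linear_continuous_on W G\<close>)
  then have 2: "isomorphic_subspaces Y (UNIV :: 'a set)"
    unfolding isomorphic_subspaces_def by (auto simp: W.add W.scaleR)
  from 1 2 show ?thesis ..
qed

end
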